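(* Let $\mathbb{F}=\mathbb{F}_q$, and for $i=1,2$ let $G_i\in\mathbb{F}_{q^m}^{k\times n_i}$ be of rank $k$ and $\mathcal{M}_i=\mathcal{M}_{G_i}$ the associated $q$-matroids. Suppose $\mathcal{M}_1$ and $\mathcal{M}_2$ are both paving. Suppose furthermore that there exist vectors $v_i\in\mathbb{F}_{q^m}^{n_i}$ with $G_iv_i^{\mathsf T}=0$ ($i=1,2$) such that $\mathrm{wt}_{\mathrm{rk}}(v_1)=\mathrm{wt}_{\mathrm{rk}}(v_2)=k$ and $\mathrm{supp}(v_1)=\mathrm{supp}(v_2)$. Then $\mathcal{M}_1\oplus\mathcal{M}_2$ is not represented by \[ G=\begin{pmatrix}G_1&0\\0&G_2\end{pmatrix}, \] i.e. $\mathcal{M}_1\oplus\mathcal{M}_2\neq\mathcal{M}_G$.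
   Context: A $q$-matroid with ground space $E$ (a finite-dimensional $\mathbb{F}_q$-vector space) is a pair $(E,\rho)$ with $\rho$ from the subspaces of $E$ to $\mathbb{N}_{\ge0}$ satisfying $0\le\rho(V)\le\dim V$, monotonicity, and submodularity $\rho(V+W)+\rho(V\cap W)\le\rho(V)+\rho(W)$; its rank is $\rho(E)$. $V$ is independent if $\rho(V)=\dim V$, dependent otherwise; a circuit is a dependent space all of whose proper subspaces are independent. A $q$-matroid is paving if every circuit $C$ has $\dim C\ge\rho(E)$. For $G\in\mathbb{F}_{q^m}^{k\times n}$, $\mathcal{M}_G=(\mathbb{F}_q^n,\rho_G)$ with $\rho_G(V)=\operatorname{rk}_{\mathbb{F}_{q^m}}(GY^{\mathsf T})$ for any $\mathbb{F}_q$-matrix $Y$ with $n$ columns and row space $V$. For $v=(v_1,\dots,v_n)\in\mathbb{F}_{q^m}^n$, $\mathrm{supp}(v)=\langle v_1,\dots,v_n\rangle_{\mathbb{F}_q}\le\mathbb{F}_{q^m}$ and $\mathrm{wt}_{\mathrm{rk}}(v)=\dim_{\mathbb{F}_q}\mathrm{supp}(v)$. Direct sum: for $q$-matroids $\mathcal{M}_i=(\mathbb{F}_q^{n_i},\rho_i)$ and $n=n_1+n_2$, write $\mathbb{F}_q^n=\mathbb{F}_q^{n_1}\oplus\mathbb{F}_q^{n_2}$ with $\pi_1,\pi_2$ the projections onto the first $n_1$ and last $n_2$ coordinates; put $\rho_i'(V)=\rho_i(\pi_i(V))$, $\mathcal{X}=\{X\le\mathbb{F}_q^n\mid\rho_1'(X)+\rho_2'(X)<\dim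 X\}$, $\mathcal{X}_0=\mathcal{X}\cup\{0\}$; then $\mathcal{M}_1\oplus\mathcal{M}_2=(\mathbb{F}_q^n,\rho)$ with $\rho(V)=\dim V+\min_{X\in\mathcal{X}_0,\,X\le V}(\rho_1'(X)+\rho_2'(X)-\dim X)$.
   Formalization: The formal theorem assumes k ≥ 2. The claim fails for k = 0 (both rank functions are zero) and can fail for k = 1: with G_1 = G_2 = (1 0) and v_1 = v_2 = (0,1) all hypotheses hold, yet M_1 ⊕ M_2 = M_G. *)

theory Defs
  imports "HOL-Analysis.Analysis"
begin

text \<open>
  The base field of order \<open>q\<close> is a type \<open>'f\<close>, the extension of degree \<open>m\<close> is a type \<open>'K\<close>
  (both finite fields), and the inclusion is given by a field embedding \<open>\<phi>\<close>. The degree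
  \<open>m\<close> is then determined by \<open>CARD('K) = CARD('f) ^ m\<close>.
\<close>

locale field_embedding =
  fixes \<phi> :: "'f::field \<Rightarrow> 'K::field"
  assumes map_one: "\<phi> 1 = 1"
    and map_add: "\<phi> (x + y) = \<phi> x + \<phi> y"
    and map_mult: "\<phi> (x * y) = \<phi> x * \<phi> y"
begin

sublocale ext: vector_space "\<lambda>c x. \<phi> c * x"
  by unfold_locales (simp_all add: map_one map_add map_mult algebra_simps)

lemma map_zero: "\<phi> 0 = 0"
  using map_add[of 0 0] by (metis add_cancel_right_right)

lemma map_sum: "\<phi> (sum f A) = (\<Sum>x\<in>A. \<phi> (f x))"
  by (induction A rule: infinite_finite_induct) (simp_all add: map_zero map_add)

end

definition rk_support :: "('f::field \<Rightarrow> 'K::field) \<Rightarrow> 'K ^ 'n \<Rightarrow> 'K set" where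
  "rk_support \<phi> v = module.span (\<lambda>c x. \<phi> c * x) (range (($) v))"

definition rk_weight :: "('f::field \<Rightarrow> 'K::field) \<Rightarrow> 'K ^ 'n \<Rightarrow> nat" where
  "rk_weight \<phi> v = vector_space.dim (\<lambda>c x. \<phi> c * x) (rk_support \<phi> v)"


text \<open>
  A \<open>q\<close>-matroid with ground space \<open>F\<^sup>n\<close> (the type \<open>'f ^ 'n\<close>) is given by its rank function.
  The rank function lives on the subspaces only; it is therefore required to be extensional
  (\<open>undefined\<close> on sets that are not subspaces), so that equality of rank functions in HOL is
  equality of \<open>q\<close>-matroids.
\<close>

definition q_matroid :: "(('f::{field,finite} ^ 'n) set \<Rightarrow> nat) \<Rightarrow> bool" where
  "q_matroid \<rho> \<longleftrightarrow>
     \<rho> \<in> extensional {V. vec.subspace V} \<and>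
     (\<forall>V. vec.subspace V \<longrightarrow> \<rho> V \<le> vec.dim V) \<and>
     (\<forall>V W. vec.subspace V \<longrightarrow> vec.subspace W \<longrightarrow> V \<subseteq> W \<longrightarrow> \<rho> V \<le> \<rho> W) \<and>
     (\<forall>V W. vec.subspace V \<longrightarrow> vec.subspace W \<longrightarrow>
        \<rho> {x + y |x y. x \<in> V \<and> y \<in> W} + \<rho> (V \<inter> W) \<le> \<rho> V + \<rho> W)"

definition qm_independent :: "(('f::{field,finite} ^ 'n) set \<Rightarrow> nat) \<Rightarrow> ('f ^ 'n) set \<Rightarrow> bool" where
  "qm_independent \<rho> V \<longleftrightarrow> vec.subspace V \<and> \<rho> V = vec.dim V"

definition qm_dependent :: "(('f::{field,finite} ^ 'n) set \<Rightarrow> nat) \<Rightarrow> ('f ^ 'n) set \<Rightarrow> bool" where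
  "qm_dependent \<rho> V \<longleftrightarrow> vec.subspace V \<and> \<rho> V \<noteq> vec.dim V"

definition qm_circuit :: "(('f::{field,finite} ^ 'n) set \<Rightarrow> nat) \<Rightarrow> ('f ^ 'n) set \<Rightarrow> bool" where
  "qm_circuit \<rho> C \<longleftrightarrow>
     qm_dependent \<rho> C \<and> (\<forall>V. vec.subspace V \<and> V \<subset> C \<longrightarrow> qm_independent \<rho> V)"

definition qm_paving :: "(('f::{field,finite} ^ 'n) set \<Rightarrow> nat) \<Rightarrow> bool" where
  "qm_paving \<rho> \<longleftrightarrow> (\<forall>C. qm_circuit \<rho> C \<longrightarrow> \<rho> UNIV \<le> vec.dim C)"


text \<open>
  Every subspace of \<open>F\<^sup>n\<close> is the row space of an \<open>n \<times> n\<close> matrix \<open>Y\<close>, and the rank of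
  \<open>G Y\<^sup>T\<close> does not depend on the choice of \<open>Y\<close>, not even on its number of rows; see
  \<open>ex_row_space\<close> and \<open>represented_qm_eq\<close> below.
\<close>

definition represented_qm ::
  "('f::{field,finite} \<Rightarrow> 'K::{field,finite}) \<Rightarrow> 'K ^ 'n ^ 'k \<Rightarrow> ('f ^ 'n) set \<Rightarrow> nat" where
  "represented_qm \<phi> G =
     (\<lambda>V\<in>{V. vec.subspace V}.
        let Y = (SOME Y :: 'f ^ 'n ^ 'n. vec.span (rows Y) = V)
        in rank (G ** transpose (map_matrix \<phi> Y)))"


lemma ex_row_space:
  fixes V :: "('f::field ^ 'n) set"
  assumes "vec.subspace V"
  shows "\<exists>Y :: 'f ^ 'n ^ 'n. vec.span (rows Y) = V"
proof -
  obtain B where B: "B \<subseteq> V" "vec.independent B" "V \<subseteq> vec.span B" "card B = vec.dim V"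
    using vec.basis_exists by blast
  have fin: "finite B" using B(2) vec.finiteI_independent by blast
  have "card B \<le> CARD('n)"
    using B(4) vec.dim_subset_UNIV[of V] by (simp add: vec.dimension_def card_cart_basis)
  then obtain g :: "'f ^ 'n \<Rightarrow> 'n" where g: "inj_on g B"
    using card_le_inj[OF fin finite_class.finite_UNIV] by blast
  define Y :: "'f ^ 'n ^ 'n" where
    "Y = (\<chi> i. if i \<in> g ` B then the_inv_into B g i else 0)"
  have row: "row i Y = (if i \<in> g ` B then the_inv_into B g i else 0)" for i
    by (simp add: Y_def row_def)
  have "rows Y \<subseteq> insert 0 B"
    using the_inv_into_into[OF g] by (auto simp: rows_def row)
  moreover have "B \<subseteq> rows Y"
  proof
    fix b assume "b \<in> B"
    then have "row (g b) Y = b" by (simp add: row the_inv_into_f_f[OF g])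
    moreover have "row (g b) Y \<in> rows Y" by (auto simp: rows_def)
    ultimately show "b \<in> rows Y" by simp
  qed
  ultimately have "vec.span (rows Y) = vec.span B"
    by (metis vec.span_insert_0 vec.span_mono subset_antisym)
  also have "\<dots> = V"
    using B assms by (meson subset_antisym vec.span_minimal)
  finally show ?thesis by blast
qed

lemma rows_subset_span_imp_factor:
  fixes Y :: "'f::field ^ 'n ^ 'r" and Z :: "'f ^ 'n ^ 's"
  assumes "rows Y \<subseteq> vec.span (rows Z)"
  shows "\<exists>A. Y = A ** Z"
proof -
  have "\<exists>a. row i Y = transpose Z *v a" for i
  proof -
    have "row i Y \<in> vec.span (columns (transpose Z))"
      using assms by (auto simp: rows_def columns_transpose)
    also have "vec.span (columns (transpose Z)) \<subseteq> range ((*v) (transpose Z))"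
    proof (rule vec.span_minimal)
      show "columns (transpose Z) \<subseteq> range ((*v) (transpose Z))"
      proof
        fix c assume "c \<in> columns (transpose Z)"
        then obtain j where "c = column j (transpose Z)" unfolding columns_def by blast
        then have "c = transpose Z *v axis j 1"
          by (simp add: vec_eq_iff column_def matrix_vector_mult_def axis_def
              if_distrib[of "(*) _"] cong: if_cong del: transpose_matrix_vector)
        then show "c \<in> range ((*v) (transpose Z))" by (rule range_eqI)
      qed
      show "vec.subspace (range ((*v) (transpose Z)))"
        by (intro vec.subspace_image vec.subspace_UNIV)
    qed
    finally show ?thesis by blast
  qed
  then obtain a where a: "\<And>i. row i Y = transpose Z *v a i" by metis
  have "Y = (\<chi> i. a i) ** Z"
  proof (simp add: vec_eq_iff, intro allI)
    fix i j
    have "Y $ i $ j = row i Y $ j" by (simp add: row_def)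
    also have "\<dots> = ((\<chi> i. a i) ** Z) $ i $ j"
      unfolding a
      by (simp add: matrix_vector_mult_def matrix_matrix_mult_def transpose_def mult.commute)
    finally show "Y $ i $ j = ((\<chi> i. a i) ** Z) $ i $ j" .
  qed
  then show ?thesis by blast
qed

lemma rank_mult_le_left:
  fixes M :: "'a::field ^ 'n ^ 'm" and N :: "'a ^ 'p ^ 'n"
  shows "rank (M ** N) \<le> rank M"
proof -
  have "row i (M ** N) = transpose N *v row i M" for i
    by (simp add: vec_eq_iff row_def matrix_vector_mult_def matrix_matrix_mult_def
        transpose_def mult.commute)
  then have "rows (M ** N) = (*v) (transpose N) ` rows M"
    by (auto simp: rows_def)
  then show ?thesis
    using vec.dim_image_le[OF matrix_vector_mul_linear_gen, of "transpose N" "rows M"]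
    by (simp only: row_rank_def_gen)
qed

lemma (in field_embedding) map_matrix_mult:
  "map_matrix \<phi> (A ** B) = map_matrix \<phi> A ** map_matrix \<phi> B"
  by (simp add: vec_eq_iff matrix_matrix_mult_def map_sum map_mult)

lemma (in field_embedding) rank_eq_if_row_space_eq:
  fixes G :: "'K ^ 'n ^ 'k" and Y :: "'f ^ 'n ^ 'r" and Z :: "'f ^ 'n ^ 's"
  assumes "vec.span (rows Y) = vec.span (rows Z)"
  shows "rank (G ** transpose (map_matrix \<phi> Y)) = rank (G ** transpose (map_matrix \<phi> Z))"
proof -
  have le: "rank (G ** transpose (map_matrix \<phi> Y)) \<le> rank (G ** transpose (map_matrix \<phi> Z))"
    if sub: "rows Y \<subseteq> vec.span (rows Z)"
    for Y :: "'f ^ 'n ^ 't" and Z :: "'f ^ 'n ^ 'u"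
  proof -
    obtain A where "Y = A ** Z" using rows_subset_span_imp_factor[OF sub] by blast
    then have "G ** transpose (map_matrix \<phi> Y) =
        (G ** transpose (map_matrix \<phi> Z)) ** transpose (map_matrix \<phi> A)"
      by (simp add: map_matrix_mult matrix_transpose_mul matrix_mul_assoc)
    then show ?thesis by (simp add: rank_mult_le_left)
  qed
  show ?thesis
    by (rule antisym; rule le) (use assms vec.span_superset[of "rows Y"] vec.span_superset[of "rows Z"] in simp_all)
qed

lemma represented_qm_eq:
  fixes \<phi> :: "'f::{field,finite} \<Rightarrow> 'K::{field,finite}"
    and G :: "'K ^ 'n ^ 'k" and Y :: "'f ^ 'n ^ 'r"
  assumes "field_embedding \<phi>" and Y: "vec.span (rows Y) = V"
  shows "represented_qm \<phi> G V = rank (G ** transpose (map_matrix \<phi> Y))"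
proof -
  interpret field_embedding \<phi> by fact
  have sub: "vec.subspace V" using Y vec.subspace_span by blast
  define Z where "Z = (SOME Z :: 'f ^ 'n ^ 'n. vec.span (rows Z) = V)"
  have "vec.span (rows Z) = V"
    unfolding Z_def using ex_row_space[OF sub] by (rule someI_ex)
  then have "rank (G ** transpose (map_matrix \<phi> Z)) = rank (G ** transpose (map_matrix \<phi> Y))"
    using Y by (intro rank_eq_if_row_space_eq) simp
  then show ?thesis
    using sub by (simp add: represented_qm_def Z_def)
qed

lemma rank_le_dim_columns:
  fixes A :: "'a::field ^ 'n ^ 'm"
  shows "rank A \<le> vec.dim (columns A)"
proof -
  obtain B where B: "B \<subseteq> columns A" "vec.independent B" "columns A \<subseteq> vec.span B"
      "card B = vec.dim (columns A)"
    using vec.basis_exists by blast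
  have fin: "finite B" using B(2) vec.finiteI_independent by blast
  have "\<exists>u. column j A = (\<Sum>b\<in>B. u b *s b)" for j
  proof -
    have "column j A \<in> vec.span B" using B(3) by (auto simp: columns_def)
    then show ?thesis by (auto simp: vec.span_finite[OF fin])
  qed
  then obtain u where u: "\<And>j. column j A = (\<Sum>b\<in>B. u j b *s b)" by metis
  have "rows A \<subseteq> vec.span ((\<lambda>b. \<chi> j. u j b) ` B)"
  proof
    fix x assume "x \<in> rows A"
    then obtain i where x: "x = row i A" by (auto simp: rows_def)
    have eq: "x = (\<Sum>b\<in>B. (b $ i) *s (\<chi> j. u j b))"
    proof (simp add: vec_eq_iff, intro allI)
      fix j
      have "x $ j = column j A $ i" by (simp add: x row_def column_def)
      also have "\<dots> = (\<Sum>b\<in>B. b $ i * u j b)" by (simp add: u mult.commute)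
      finally show "x $ j = (\<Sum>b\<in>B. b $ i * u j b)" .
    qed
    show "x \<in> vec.span ((\<lambda>b. \<chi> j. u j b) ` B)"
      unfolding eq by (intro vec.span_sum vec.span_scale vec.span_base imageI)
  qed
  then have "rank A \<le> card ((\<lambda>b. \<chi> j. u j b) ` B)"
    unfolding row_rank_def_gen by (rule vec.dim_le_card) (simp add: fin)
  also have "\<dots> \<le> card B" by (rule card_image_le[OF fin])
  finally show ?thesis using B(4) by simp
qed

lemma rank_eq_dim_columns:
  fixes A :: "'a::field ^ 'n ^ 'm"
  shows "rank A = vec.dim (columns A)"
  using rank_le_dim_columns[of A] rank_le_dim_columns[of "transpose A"]
  by (simp add: row_rank_def_gen rows_transpose columns_transpose)

lemma represented_qm_eq_dim:
  fixes \<phi> :: "'f::{field,finite} \<Rightarrow> 'K::{field,finite}"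
    and G :: "'K ^ 'n ^ 'k"
  assumes "field_embedding \<phi>" and V: "vec.span B = V"
  shows "represented_qm \<phi> G V = vec.dim ((\<lambda>y. G *v (\<chi> j. \<phi> (y $ j))) ` B)"
proof -
  interpret field_embedding \<phi> by fact
  define t where "t = (\<lambda>y :: 'f ^ 'n. G *v (\<chi> j. \<phi> (y $ j)))"
  have t_add: "t (x + y) = t x + t y" for x y
    by (simp add: t_def vec_eq_iff matrix_vector_mult_def map_add sum.distrib distrib_left)
  have t_scale: "t (c *s x) = \<phi> c *s t x" for c x
    by (simp add: t_def vec_eq_iff matrix_vector_mult_def map_mult sum_distrib_left
        mult.left_commute)
  have t_zero: "t 0 = 0"
    by (simp add: t_def vec_eq_iff matrix_vector_mult_def map_zero)
  have t_span: "vec.span (t ` vec.span S) = vec.span (t ` S)" for S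
  proof (rule antisym)
    have "t x \<in> vec.span (t ` S)" if "x \<in> vec.span S" for x
      using that
    proof (induction rule: vec.span_induct_alt)
      case base
      show ?case by (simp only: t_zero vec.span_zero)
    next
      case (step c x y)
      then show ?case
        unfolding t_add t_scale
        by (blast intro: vec.span_add vec.span_scale vec.span_base)
    qed
    then show "vec.span (t ` vec.span S) \<subseteq> vec.span (t ` S)"
      by (intro vec.span_minimal) auto
    show "vec.span (t ` S) \<subseteq> vec.span (t ` vec.span S)"
      by (intro vec.span_mono image_mono vec.span_superset)
  qed
  have sub: "vec.subspace V" using V vec.subspace_span by blast
  obtain Y :: "'f ^ 'n ^ 'n" where Y: "vec.span (rows Y) = V"
    using ex_row_space[OF sub] by blast
  have "column i (G ** transpose (map_matrix \<phi> Y)) = t (row i Y)" for i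
    by (simp add: t_def vec_eq_iff column_def row_def matrix_matrix_mult_def
        matrix_vector_mult_def transpose_def)
  then have "columns (G ** transpose (map_matrix \<phi> Y)) = t ` rows Y"
    by (auto simp: columns_def rows_def)
  then have "represented_qm \<phi> G V = vec.dim (t ` rows Y)"
    using represented_qm_eq[OF assms(1) Y, of G] by (simp add: rank_eq_dim_columns)
  also have "\<dots> = vec.dim (vec.span (t ` vec.span (rows Y)))"
    by (simp only: t_span vec.dim_span)
  also have "\<dots> = vec.dim (t ` B)"
    by (simp only: Y V[symmetric] t_span vec.dim_span)
  finally show ?thesis by (simp add: t_def)
qed

lemma q_matroid_represented_qm:
  fixes \<phi> :: "'f::{field,finite} \<Rightarrow> 'K::{field,finite}"
    and G :: "'K ^ 'n ^ 'k"
  assumes \<phi>: "field_embedding \<phi>"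
  shows "q_matroid (represented_qm \<phi> G)"
proof -
  interpret field_embedding \<phi> by fact
  define t where "t = (\<lambda>y :: 'f ^ 'n. G *v (\<chi> j. \<phi> (y $ j)))"
  have t_add: "t (x + y) = t x + t y" for x y
    by (simp add: t_def vec_eq_iff matrix_vector_mult_def map_add sum.distrib distrib_left)
  have rk: "represented_qm \<phi> G V = vec.dim (t ` B)" if "vec.span B = V" for B V
    using represented_qm_eq_dim[OF \<phi> that] by (simp add: t_def)
  have rk': "represented_qm \<phi> G V = vec.dim (t ` V)" if "vec.subspace V" for V
    using rk[of V V] that by (simp add: vec.span_eq_iff)
  have bound: "represented_qm \<phi> G V \<le> vec.dim V" if V: "vec.subspace V" for V
  proof -
    obtain B where B: "B \<subseteq> V" "vec.independent B" "V \<subseteq> vec.span B" "card B = vec.dim V"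
      using vec.basis_exists by blast
    have "vec.span B = V" using B V by (meson subset_antisym vec.span_minimal)
    then have "represented_qm \<phi> G V = vec.dim (t ` B)" by (rule rk)
    also have "\<dots> \<le> card (t ` B)" by (rule vec.dim_le_card') simp
    also have "\<dots> \<le> card B" by (rule card_image_le) simp
    finally show ?thesis using B(4) by simp
  qed
  have mono: "represented_qm \<phi> G V \<le> represented_qm \<phi> G W"
    if "vec.subspace V" "vec.subspace W" "V \<subseteq> W" for V W
    using that by (simp add: rk' vec.dim_subset image_mono)
  have submod: "represented_qm \<phi> G {x + y |x y. x \<in> V \<and> y \<in> W} + represented_qm \<phi> G (V \<inter> W)
      \<le> represented_qm \<phi> G V + represented_qm \<phi> G W"
    if V: "vec.subspace V" and W: "vec.subspace W" for V W
  proof -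
    let ?S = "vec.span (t ` V)" and ?T = "vec.span (t ` W)"
    have "t ` {x + y |x y. x \<in> V \<and> y \<in> W} \<subseteq> {x + y |x y. x \<in> ?S \<and> y \<in> ?T}"
    proof clarify
      fix x y assume "x \<in> V" "y \<in> W"
      then show "\<exists>a b. t (x + y) = a + b \<and> a \<in> ?S \<and> b \<in> ?T"
        by (intro exI[of _ "t x"] exI[of _ "t y"]) (simp add: t_add vec.span_base)
    qed
    then have 1: "represented_qm \<phi> G {x + y |x y. x \<in> V \<and> y \<in> W}
        \<le> vec.dim {x + y |x y. x \<in> ?S \<and> y \<in> ?T}"
      using rk'[OF vec.subspace_sums[OF V W]] by (simp add: vec.dim_subset)
    have "t ` (V \<inter> W) \<subseteq> ?S \<inter> ?T" by (auto intro: vec.span_base)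
    then have 2: "represented_qm \<phi> G (V \<inter> W) \<le> vec.dim (?S \<inter> ?T)"
      using rk'[OF vec.subspace_inter[OF V W]] by (simp add: vec.dim_subset)
    have "vec.dim {x + y |x y. x \<in> ?S \<and> y \<in> ?T} + vec.dim (?S \<inter> ?T) = vec.dim ?S + vec.dim ?T"
      by (rule vec.dim_sums_Int) simp_all
    with 1 2 show ?thesis using V W by (simp add: rk')
  qed
  have "represented_qm \<phi> G \<in> extensional {V. vec.subspace V}"
    by (simp add: represented_qm_def)
  then show ?thesis
    unfolding q_matroid_def by (intro conjI allI impI bound mono submod)
qed


text \<open>
  Coordinates of \<open>F\<^sup>n\<close> with \<open>n = n\<^sub>1 + n\<^sub>2\<close> are indexed by the sum type \<open>'n1 + 'n2\<close>.
\<close>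

definition proj_left :: "'a ^ ('n1::finite + 'n2::finite) \<Rightarrow> 'a ^ 'n1" where
  "proj_left x = (\<chi> i. x $ Inl i)"

definition proj_right :: "'a ^ ('n1::finite + 'n2::finite) \<Rightarrow> 'a ^ 'n2" where
  "proj_right x = (\<chi> i. x $ Inr i)"

definition qm_direct_sum ::
  "(('f::{field,finite} ^ 'n1) set \<Rightarrow> nat) \<Rightarrow> (('f ^ 'n2) set \<Rightarrow> nat) \<Rightarrow>
   ('f ^ ('n1 + 'n2)) set \<Rightarrow> nat" where
  "qm_direct_sum \<rho>1 \<rho>2 =
     (let \<rho>1' = (\<lambda>V. \<rho>1 (proj_left ` V));
          \<rho>2' = (\<lambda>V. \<rho>2 (proj_right ` V));
          \<X> = {X. vec.subspace X \<and> \<rho>1' X + \<rho>2' X < vec.dim X};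
          \<X>\<^sub>0 = \<X> \<union> {{0}}
      in (\<lambda>V\<in>{V. vec.subspace V}.
           nat (int (vec.dim V) +
                Min {int (\<rho>1' X) + int (\<rho>2' X) - int (vec.dim X) |X. X \<in> \<X>\<^sub>0 \<and> X \<subseteq> V})))"

definition block_diag ::
  "'a::zero ^ 'n1 ^ 'k1 \<Rightarrow> 'a ^ 'n2 ^ 'k2 \<Rightarrow> 'a ^ ('n1::finite + 'n2::finite) ^ ('k1::finite + 'k2::finite)" where
  "block_diag A B =
     (\<chi> i j. case (i, j) of
        (Inl i', Inl j') \<Rightarrow> A $ i' $ j'
      | (Inr i', Inr j') \<Rightarrow> B $ i' $ j'
      | _ \<Rightarrow> 0)"

end

theory Submission
  imports Defs
begin

text \<open>
  Choose an \<open>F\<close>-basis \<open>B\<close> of the common support and expand \<open>v\<^sub>1 = \<Sum>b y\<^sub>b\<close> and \<open>v\<^sub>2 = \<Sum>b z\<^sub>b\<close> over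
  \<open>b \<in> B\<close>. The \<open>y\<^sub>b\<close> are linearly independent over \<open>F\<close>, and so are the \<open>z\<^sub>b\<close>; hence the span
  \<open>V\<close> of the vectors \<open>(y\<^sub>b, z\<^sub>b)\<close> has dimension \<open>k\<close> and both projections are injective on it.
  Since \<open>G (v\<^sub>1, v\<^sub>2) = 0\<close>, the space \<open>V\<close> is dependent in \<open>\<M>\<^sub>G\<close>. It is independent in the direct
  sum: in a paving matroid of rank \<open>k\<close> a space of dimension below \<open>k\<close> is independent and one
  of dimension \<open>k\<close> has rank at least \<open>k - 1\<close>, so every \<open>X \<le> V\<close> satisfies
  \<open>\<rho>\<^sub>1(\<pi>\<^sub>1 X) + \<rho>\<^sub>2(\<pi>\<^sub>2 X) \<ge> dim X\<close>, the case \<open>X = V\<close> using \<open>2 (k - 1) \<ge> k\<close>.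
\<close>

section \<open>Circuits and small spaces in paving q-matroids\<close>

lemma q_matroid_zero_space:
  assumes "q_matroid \<rho>"
  shows "\<rho> {0} = 0"
proof -
  have "\<forall>V. vec.subspace V \<longrightarrow> \<rho> V \<le> vec.dim V"
    using assms by (simp add: q_matroid_def)
  from this[rule_format, OF vec.subspace_single_0] show ?thesis by simp
qed

text \<open>Induction on the dimension: a dependent space that is not a circuit has a dependent
  proper subspace.\<close>

lemma qm_dependent_imp_circuit:
  assumes "qm_dependent \<rho> V"
  shows "\<exists>C \<subseteq> V. qm_circuit \<rho> C"
  using assms
proof (induction "vec.dim V" arbitrary: V rule: less_induct)
  case less
  show ?case
  proof (cases "qm_circuit \<rho> V")
    case False
    then obtain W where W: "vec.subspace W" "W \<subset> V" "\<not> qm_independent \<rho> W"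
      using less.prems by (auto simp: qm_circuit_def)
    have "vec.subspace V" using less.prems by (simp add: qm_dependent_def)
    then have "vec.span W \<subset> vec.span V"
      using W by (metis vec.span_eq_iff)
    then have "vec.dim W < vec.dim V" by (rule vec.dim_psubset)
    moreover have "qm_dependent \<rho> W"
      using W by (simp add: qm_dependent_def qm_independent_def)
    ultimately obtain C where "C \<subseteq> W" "qm_circuit \<rho> C" using less.hyps by blast
    then show ?thesis using W by blast
  qed blast
qed

text \<open>A dependent \<open>V\<close> would contain a circuit of dimension below the rank, which
  paving forbids.\<close>

lemma qm_paving_rank_eq_dim:
  assumes "qm_paving \<rho>" and "vec.subspace V" and "vec.dim V < \<rho> UNIV"
  shows "\<rho> V = vec.dim V"
proof (rule ccontr)
  assume "\<rho> V \<noteq> vec.dim V"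
  then have "qm_dependent \<rho> V" using assms by (simp add: qm_dependent_def)
  then obtain C where C: "C \<subseteq> V" "qm_circuit \<rho> C" using qm_dependent_imp_circuit by blast
  then have "\<rho> UNIV \<le> vec.dim C" using assms(1) by (simp add: qm_paving_def)
  also have "\<dots> \<le> vec.dim V" using C(1) by (rule vec.dim_subset)
  finally show False using assms(3) by simp
qed

text \<open>A hyperplane of \<open>V\<close> has dimension below the rank, so it is independent;
  monotonicity carries its rank over to \<open>V\<close>.\<close>

lemma qm_paving_dim_le_Suc_rank:
  assumes qm: "q_matroid \<rho>" and paving: "qm_paving \<rho>"
    and V: "vec.subspace V" and dim: "vec.dim V \<le> \<rho> UNIV"
  shows "vec.dim V \<le> Suc (\<rho> V)"
proof (cases "vec.dim V")
  case (Suc d)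
  then obtain W where W: "vec.subspace W" "W \<subseteq> V" "vec.dim W = d"
    using vec.choose_subspace_of_subspace[of d V] V by (metis le_SucI order_refl vec.span_eq_iff)
  then have "\<rho> W = d" using qm_paving_rank_eq_dim[OF paving W(1)] Suc dim by simp
  moreover have "\<rho> W \<le> \<rho> V" using qm W V by (simp add: q_matroid_def)
  ultimately show ?thesis using Suc by simp
qed linarith

text \<open>The identity matrix has row space \<open>UNIV\<close>. This turns the rank hypotheses on
  the matrices into the threshold used by paving.\<close>

lemma represented_qm_UNIV:
  fixes \<phi> :: "'f::{field,finite} \<Rightarrow> 'K::{field,finite}" and G :: "'K ^ 'n ^ 'k"
  assumes "field_embedding \<phi>"
  shows "represented_qm \<phi> G UNIV = rank G"
proof -
  interpret field_embedding \<phi> by fact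
  have "rows (mat 1 :: 'f ^ 'n ^ 'n) = cart_basis"
    by (auto simp: rows_def row_def cart_basis_def mat_def axis_def vec_eq_iff)
  then have "vec.span (rows (mat 1 :: 'f ^ 'n ^ 'n)) = UNIV" by simp
  moreover have "map_matrix \<phi> (mat 1 :: 'f ^ 'n ^ 'n) = mat 1"
    by (simp add: vec_eq_iff mat_def map_zero map_one)
  ultimately show ?thesis
    using represented_qm_eq[OF assms, of "mat 1 :: 'f ^ 'n ^ 'n" UNIV G] by simp
qed

section \<open>Coordinate projections and independence in the direct sum\<close>

lemma linear_proj_left: "Vector_Spaces.linear (*s) (*s) (proj_left :: 'a::field ^ ('m::finite + 'n::finite) \<Rightarrow> _)"
  by unfold_locales (simp_all add: proj_left_def vec_eq_iff algebra_simps)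

lemma linear_proj_right: "Vector_Spaces.linear (*s) (*s) (proj_right :: 'a::field ^ ('m::finite + 'n::finite) \<Rightarrow> _)"
  by unfold_locales (simp_all add: proj_right_def vec_eq_iff algebra_simps)

lemma qm_direct_sum_eq_dim:
  fixes \<rho>1 :: "('f::{field,finite} ^ 'n1) set \<Rightarrow> nat" and \<rho>2 :: "('f ^ 'n2) set \<Rightarrow> nat"
  assumes V: "vec.subspace V"
    and le: "\<And>X. vec.subspace X \<Longrightarrow> X \<subseteq> V \<Longrightarrow>
      vec.dim X \<le> \<rho>1 (proj_left ` X) + \<rho>2 (proj_right ` X)"
    and "\<rho>1 {0} = 0" and "\<rho>2 {0} = 0"
  shows "qm_direct_sum \<rho>1 \<rho>2 V = vec.dim V"
proof -
  let ?r = "\<lambda>X. \<rho>1 (proj_left ` X) + \<rho>2 (proj_right ` X)"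
  have "{int (\<rho>1 (proj_left ` X)) + int (\<rho>2 (proj_right ` X)) - int (vec.dim X) |X.
      X \<in> {X. vec.subspace X \<and> ?r X < vec.dim X} \<union> {{0}} \<and> X \<subseteq> V} = {0}"
  proof -
    have "X \<in> {X. vec.subspace X \<and> ?r X < vec.dim X} \<union> {{0}} \<and> X \<subseteq> V \<longleftrightarrow> X = {0}" for X
      using le[of X] vec.subspace_0[OF V] by auto
    moreover have "proj_left ` {0 :: 'f ^ ('n1 + 'n2)} = {0}"
      "proj_right ` {0 :: 'f ^ ('n1 + 'n2)} = {0}"
      by (simp_all add: proj_left_def proj_right_def vec_eq_iff)
    moreover have "vec.dim {0 :: 'f ^ ('n1 + 'n2)} = 0"
      by simp
    ultimately show ?thesis using assms(3,4) by simp
  qed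
  then show ?thesis using V by (simp add: qm_direct_sum_def)
qed

section \<open>Expansion over a basis of the support, and linear relations in finite
  families\<close>

text \<open>
  If \<open>\<Sum>u\<^sub>b y\<^sub>b = 0\<close>, then the functional \<open>b \<mapsto> u\<^sub>b\<close> kills all entries of \<open>v\<close>, hence their span,
  hence every \<open>b\<close>.
\<close>

lemma (in field_embedding) ex_support_expansion:
  fixes v :: "'K ^ 'n"
  assumes B: "ext.independent B" "finite B" and supp: "ext.span B = rk_support \<phi> v"
  obtains y :: "'K \<Rightarrow> 'f ^ 'n"
  where "\<And>j. v $ j = (\<Sum>b\<in>B. b * \<phi> (y b $ j))"
    and "\<And>u b. (\<Sum>b\<in>B. u b *s y b) = 0 \<Longrightarrow> b \<in> B \<Longrightarrow> u b = 0"
proof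
  define y :: "'K \<Rightarrow> 'f ^ 'n" where "y b = (\<chi> j. ext.representation B (v $ j) b)" for b
  have v_in: "v $ j \<in> ext.span B" for j
    unfolding supp rk_support_def by (intro ext.span_base) simp
  show "v $ j = (\<Sum>b\<in>B. b * \<phi> (y b $ j))" for j
    using ext.sum_representation_eq[OF B(1) v_in B(2) order_refl, of j]
    by (simp add: y_def mult.commute)
  fix u b assume u: "(\<Sum>b\<in>B. u b *s y b) = 0" and b: "b \<in> B"
  let ?L = "\<lambda>x. \<Sum>b\<in>B. u b * ext.representation B x b"
  \<comment> \<open>The set is cut down to \<open>ext.span B\<close> because
    \<open>ext.representation\<close> is 0 by default outside the span, so \<open>?L\<close> is
    known to be additive only inside it.\<close>
  have "rk_support \<phi> v \<subseteq> {x \<in> ext.span B. ?L x = 0}"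
    unfolding rk_support_def
  proof (rule ext.span_minimal)
    have "?L (v $ j) = (\<Sum>b\<in>B. u b *s y b) $ j" for j by (simp add: y_def)
    then show "range (($) v) \<subseteq> {x \<in> ext.span B. ?L x = 0}"
      using v_in u by auto
    show "ext.subspace {x \<in> ext.span B. ?L x = 0}"
    proof (rule ext.subspaceI)
      show "0 \<in> {x \<in> ext.span B. ?L x = 0}"
        by (simp add: ext.representation_zero ext.span_zero)
    next
      fix x x' assume "x \<in> {x \<in> ext.span B. ?L x = 0}" "x' \<in> {x \<in> ext.span B. ?L x = 0}"
      then show "x + x' \<in> {x \<in> ext.span B. ?L x = 0}"
        using B(1) by (simp add: ext.representation_add ext.span_add distrib_left sum.distrib)
    next
      fix c x assume x: "x \<in> {x \<in> ext.span B. ?L x = 0}"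
      have "?L (\<phi> c * x) = c * ?L x"
        using x B(1) by (simp add: ext.representation_scale sum_distrib_left[symmetric] mult.left_commute[of _ c])
      moreover have "?L x = 0" using x by simp
      ultimately have "?L (\<phi> c * x) = 0" by (simp only: mult_zero_right)
      then show "\<phi> c * x \<in> {x \<in> ext.span B. ?L x = 0}"
        using x ext.span_scale by blast
    qed
  qed
  then have "?L b = 0" using b supp ext.span_base[OF b] by auto
  then show "u b = 0"
    using b B by (simp add: ext.representation_basis if_distrib[of "(*) _"] sum.delta' cong: if_cong)
qed

text \<open>A relation among the \<open>w b\<close> maps under \<open>p\<close> to one among the
  \<open>p (w b)\<close>, so independence of the images passes back to the \<open>w b\<close> and
  leaves no nonzero kernel vector in their span. Independence is that of an indexed family, so it
  also makes the \<open>w b\<close> distinct.\<close>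

lemma linear_inj_on_span_family:
  fixes w :: "'b \<Rightarrow> 'a::field ^ 'n" and p :: "'a ^ 'n \<Rightarrow> 'a ^ 'm"
  assumes p: "Vector_Spaces.linear (*s) (*s) p" and B: "finite B"
    and indep: "\<And>u b. (\<Sum>b\<in>B. u b *s p (w b)) = 0 \<Longrightarrow> b \<in> B \<Longrightarrow> u b = 0"
  shows "inj_on p (vec.span (w ` B))" and "vec.dim (vec.span (w ` B)) = card B"
proof -
  interpret p: Vector_Spaces.linear "(*s)" "(*s)" p by fact
  have inj: "inj_on w B"
  proof (rule inj_onI, rule ccontr)
    fix b c assume bc: "b \<in> B" "c \<in> B" "w b = w c" "b \<noteq> c"
    \<comment> \<open>If \<open>w b = w c\<close>, the coefficients 1 at \<open>b\<close> and -1 at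
      \<open>c\<close> give a nontrivial relation.\<close>
    let ?u = "\<lambda>x. (if x = b then 1 else 0) - (if x = c then 1 else 0) :: 'a"
    have "(\<Sum>x\<in>B. ?u x *s p (w x))
        = (\<Sum>x\<in>B. if x = b then p (w x) else 0) - (\<Sum>x\<in>B. if x = c then p (w x) else 0)"
      unfolding sum_subtractf[symmetric] by (rule sum.cong) auto
    also have "\<dots> = 0" using bc B by simp
    finally show False using indep[of ?u b] bc by simp
  qed
  have zero: "x = 0" if x: "x \<in> vec.span (w ` B)" "p x = 0" for x
  proof -
    obtain u where "x = (\<Sum>v\<in>w ` B. u v *s v)" using x(1) B by (auto simp: vec.span_finite)
    then have eq: "x = (\<Sum>b\<in>B. u (w b) *s w b)" by (simp add: sum.reindex[OF inj])
    then have "(\<Sum>b\<in>B. u (w b) *s p (w b)) = 0" using x(2) by (simp add: p.sum p.scale)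
    then have "u (w b) = 0" if "b \<in> B" for b using indep that by fast
    then show ?thesis using eq by simp
  qed
  show "inj_on p (vec.span (w ` B))"
    using zero by (simp add: p.inj_on_iff_eq_0)
  have "vec.independent (w ` B)"
  proof (rule vec.independent_if_scalars_zero)
    show "finite (w ` B)" using B by simp
  next
    fix u x assume u: "(\<Sum>x\<in>w ` B. u x *s x) = 0" and x: "x \<in> w ` B"
    then have "p (\<Sum>b\<in>B. u (w b) *s w b) = 0" by (simp add: sum.reindex[OF inj])
    then have "(\<Sum>b\<in>B. u (w b) *s p (w b)) = 0" by (simp add: p.sum p.scale)
    then show "u x = 0" using indep[of "\<lambda>b. u (w b)"] x by auto
  qed
  then show "vec.dim (vec.span (w ` B)) = card B"
    by (simp add: vec.dim_eq_card_independent card_image[OF inj])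
qed

text \<open>Solving the relation for \<open>x b\<close> puts it in the span of the other vectors.
  The bound counts indices, so \<open>x\<close> may repeat values.\<close>

lemma dim_image_less_card_if_relation:
  fixes x :: "'b \<Rightarrow> 'a::field ^ 'n"
  assumes B: "finite B" and rel: "(\<Sum>b\<in>B. a b *s x b) = 0" and b: "b \<in> B" "a b \<noteq> 0"
  shows "vec.dim (x ` B) < card B"
proof -
  have "a b *s x b = - (\<Sum>c\<in>B - {b}. a c *s x c)"
    using rel b B by (simp add: sum.remove eq_neg_iff_add_eq_0)
  moreover have "(\<Sum>c\<in>B - {b}. a c *s x c) \<in> vec.span (x ` (B - {b}))"
    by (intro vec.span_sum vec.span_scale vec.span_base imageI)
  ultimately have "a b *s x b \<in> vec.span (x ` (B - {b}))" by (simp add: vec.span_neg)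
  then have "inverse (a b) *s (a b *s x b) \<in> vec.span (x ` (B - {b}))" by (rule vec.span_scale)
  then have "x b \<in> vec.span (x ` (B - {b}))" using b by simp
  then have "x ` B \<subseteq> vec.span (x ` (B - {b}))"
    by (auto intro: vec.span_base)
  then have "vec.dim (x ` B) \<le> card (x ` (B - {b}))" using B by (simp add: vec.dim_le_card)
  also have "\<dots> \<le> card (B - {b})" using B by (simp add: card_image_le)
  also have "\<dots> < card B" using B b by (rule_tac card_Diff1_less)
  finally show ?thesis .
qed

lemma block_diag_mult_vec:
  fixes A :: "'a::semiring_1 ^ 'n1 ^ 'k1" and B :: "'a ^ 'n2 ^ 'k2"
  shows "block_diag A B *v x =
    (\<chi> i. case i of Inl i' \<Rightarrow> (A *v proj_left x) $ i' | Inr i' \<Rightarrow> (B *v proj_right x) $ i')"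
proof -
  have sum: "sum f UNIV = (\<Sum>i\<in>UNIV. f (Inl i)) + (\<Sum>i\<in>UNIV. f (Inr i))"
    for f :: "'n1 + 'n2 \<Rightarrow> 'a"
    using sum.Plus[of UNIV UNIV f] by (simp add: comp_def)
  show ?thesis
    by (auto simp: vec_eq_iff matrix_vector_mult_def block_diag_def proj_left_def proj_right_def
        sum split: sum.split)
qed

theorem theorem3p6:
  fixes \<phi> :: "'f::{field,finite} \<Rightarrow> 'K::{field,finite}"
    and G1 :: "'K ^ 'n1 ^ 'k"
    and G2 :: "'K ^ 'n2 ^ 'k"
  assumes "field_embedding \<phi>"
    and "CARD('k) \<ge> 2"
    and "rank G1 = CARD('k)"
    and "rank G2 = CARD('k)"
    and "qm_paving (represented_qm \<phi> G1)"
    and "qm_paving (represented_qm \<phi> G2)"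
    and "\<exists>(v1 :: 'K ^ 'n1) (v2 :: 'K ^ 'n2).
           G1 *v v1 = 0 \<and> G2 *v v2 = 0 \<and>
           rk_weight \<phi> v1 = CARD('k) \<and> rk_weight \<phi> v2 = CARD('k) \<and>
           rk_support \<phi> v1 = rk_support \<phi> v2"
  shows "qm_direct_sum (represented_qm \<phi> G1) (represented_qm \<phi> G2)
           \<noteq> represented_qm \<phi> (block_diag G1 G2)"
proof -
  interpret field_embedding \<phi> by fact
  let ?\<rho>1 = "represented_qm \<phi> G1" and ?\<rho>2 = "represented_qm \<phi> G2"
  let ?G = "block_diag G1 G2"
  obtain v1 :: "'K ^ 'n1" and v2 :: "'K ^ 'n2" where
    v: "G1 *v v1 = 0" "G2 *v v2 = 0" "rk_weight \<phi> v1 = CARD('k)"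
      "rk_support \<phi> v1 = rk_support \<phi> v2"
    using assms(7) by blast
  obtain B where B: "B \<subseteq> rk_support \<phi> v1" "ext.independent B"
      "rk_support \<phi> v1 \<subseteq> ext.span B" "card B = CARD('k)"
    using ext.basis_exists[of "rk_support \<phi> v1"] v(3) unfolding rk_weight_def by metis
  have fin: "finite B" by simp
  have "ext.subspace (rk_support \<phi> v1)"
    unfolding rk_support_def by (rule ext.subspace_span)
  then have supp: "ext.span B = rk_support \<phi> v1"
    using ext.span_minimal[OF B(1)] B(3) by blast
  obtain y :: "'K \<Rightarrow> 'f ^ 'n1" where
    y: "\<And>j. v1 $ j = (\<Sum>b\<in>B. b * \<phi> (y b $ j))"
    and y_indep: "\<And>u b. (\<Sum>b\<in>B. u b *s y b) = 0 \<Longrightarrow> b \<in> B \<Longrightarrow> u b = 0"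
    using ex_support_expansion[OF B(2) fin supp] by metis
  \<comment> \<open>Equality of the supports enters here: the same \<open>B\<close> serves
    \<open>v2\<close>, so both expansions share their coefficients.\<close>
  obtain z :: "'K \<Rightarrow> 'f ^ 'n2" where
    z: "\<And>j. v2 $ j = (\<Sum>b\<in>B. b * \<phi> (z b $ j))"
    and z_indep: "\<And>u b. (\<Sum>b\<in>B. u b *s z b) = 0 \<Longrightarrow> b \<in> B \<Longrightarrow> u b = 0"
    using ex_support_expansion[OF B(2) fin supp[unfolded v(4)]] by metis
  define w :: "'K \<Rightarrow> 'f ^ ('n1 + 'n2)" where
    "w b = (\<chi> j. case j of Inl i \<Rightarrow> y b $ i | Inr i \<Rightarrow> z b $ i)" for b
  define V where "V = vec.span (w ` B)"
  have V: "vec.subspace V" by (simp add: V_def)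
  have w: "proj_left (w b) = y b" "proj_right (w b) = z b" for b
    by (simp_all add: w_def proj_left_def proj_right_def vec_eq_iff)
  \<comment> \<open>The projections of the \<open>w b\<close> are the independent families
    \<open>y b\<close> and \<open>z b\<close>, so each projection is injective on
    \<open>V\<close>.\<close>
  have inj1: "inj_on proj_left V" and dim_V: "vec.dim V = CARD('k)"
    using linear_inj_on_span_family[OF linear_proj_left fin, of w] y_indep
    unfolding V_def w B(4)[symmetric] by blast+
  have inj2: "inj_on proj_right V"
    using linear_inj_on_span_family[OF linear_proj_right fin, of w] z_indep
    unfolding V_def w by blast

  have qm: "q_matroid ?\<rho>1" "q_matroid ?\<rho>2"
    using assms(1) by (simp_all add: q_matroid_represented_qm)
  have UNIV: "?\<rho>1 UNIV = CARD('k)" "?\<rho>2 UNIV = CARD('k)"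
    using assms by (simp_all add: represented_qm_UNIV)
  have "qm_direct_sum ?\<rho>1 ?\<rho>2 V = vec.dim V"
  proof (rule qm_direct_sum_eq_dim[OF V])
    fix X assume X: "vec.subspace X" "X \<subseteq> V"
    then have span_X: "vec.span X = X" by (simp add: vec.span_eq_iff)
    have dim_X: "vec.dim (proj_left ` X) = vec.dim X" "vec.dim (proj_right ` X) = vec.dim X"
      using vec.dim_image_eq[OF linear_proj_left] vec.dim_image_eq[OF linear_proj_right]
        inj_on_subset[OF inj1 X(2)] inj_on_subset[OF inj2 X(2)] span_X by metis+
    have sub: "vec.subspace (proj_left ` X)" "vec.subspace (proj_right ` X)"
      using X(1) vec.linear_subspace_image[OF linear_proj_left]
        vec.linear_subspace_image[OF linear_proj_right] by blast+
    have "vec.dim X \<le> CARD('k)" using vec.dim_subset[OF X(2)] dim_V by simp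
    then consider "vec.dim X < CARD('k)" | "vec.dim X = CARD('k)" by linarith
    then show "vec.dim X \<le> ?\<rho>1 (proj_left ` X) + ?\<rho>2 (proj_right ` X)"
    proof cases
      case 1
      \<comment> \<open>Below dimension k the left summand alone reaches the dimension of
        \<open>X\<close>.\<close>
      then have "?\<rho>1 (proj_left ` X) = vec.dim X"
        using qm_paving_rank_eq_dim[OF assms(5) sub(1)] UNIV dim_X by simp
      then show ?thesis by simp
    next
      case 2
      \<comment> \<open>Each summand falls short by at most 1, which the sum absorbs because k \<ge>
        2.\<close>
      then have "vec.dim X \<le> Suc (?\<rho>1 (proj_left ` X))" "vec.dim X \<le> Suc (?\<rho>2 (proj_right ` X))"
        using qm_paving_dim_le_Suc_rank[OF qm(1) assms(5) sub(1)]
          qm_paving_dim_le_Suc_rank[OF qm(2) assms(6) sub(2)] UNIV dim_X by simp_all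
      then show ?thesis using 2 assms(2) by linarith
    qed
  next
    show "?\<rho>1 {0} = 0" "?\<rho>2 {0} = 0"
      by (rule qm[THEN q_matroid_zero_space])+
  qed
  moreover have "represented_qm \<phi> ?G V < vec.dim V"
  proof -
    let ?t = "\<lambda>x. ?G *v (\<chi> j. \<phi> (x $ j))"
    obtain b where b: "b \<in> B" using B(4) by fastforce
    have "b \<noteq> 0" using B(2) b ext.dependent_zero by blast
    \<comment> \<open>The coefficients are the basis elements themselves. They are nonzero scalars
      of \<open>'K\<close>, the field over which the rank is counted, so the relation lowers the
      rank although the \<open>w b\<close> are independent over \<open>'f\<close>.\<close>
    have "(\<Sum>b\<in>B. b *s ?t (w b)) = ?G *v (\<Sum>b\<in>B. b *s (\<chi> j. \<phi> (w b $ j)))"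
      by (simp add: vec.sum vec.scale)
    \<comment> \<open>Recombining the expansions returns the concatenation of \<open>v1\<close> and
      \<open>v2\<close>, whose two halves are killed by the two blocks.\<close>
    also have "(\<Sum>b\<in>B. b *s (\<chi> j. \<phi> (w b $ j))) = (\<chi> j. case j of Inl i \<Rightarrow> v1 $ i | Inr i \<Rightarrow> v2 $ i)"
      by (auto simp: vec_eq_iff w_def y z split: sum.split)
    also have "?G *v \<dots> = 0"
      using v by (auto simp: block_diag_mult_vec proj_left_def proj_right_def vec_eq_iff split: sum.split)
    finally have "vec.dim ((\<lambda>b. ?t (w b)) ` B) < card B"
      by (rule dim_image_less_card_if_relation[OF fin, where a = "\<lambda>b. b" and b = b]) (use b \<open>b \<noteq> 0\<close> in auto)
    moreover have "represented_qm \<phi> ?G V = vec.dim (?t ` w ` B)"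
      by (rule represented_qm_eq_dim[OF assms(1)]) (simp add: V_def)
    ultimately show ?thesis using dim_V B(4) by (simp add: image_image)
  qed
  ultimately show ?thesis by (metis less_irrefl)
qed

end
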